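(* Assume that the linear system $\dot x=L(t)x$ is exponentially stable, and let $$A_t=\Big\{\rho\int_{-\infty}^t\Psi(t,s)\xi(s)\,ds : \xi\in\mathcal{U}\Big\},\qquad t\in\mathbb{R}.$$ Then $\mathcal{A}=(A_t)_{t\in\mathbb{R}}$ is fibre-wise closed, i.e. $A_t$ is a closed subset of $\mathbb{R}^d$ for every $t\in\mathbb{R}$.
   Context: Let $d\ge2$, $\rho>0$, $L:\mathbb{R}\to\mathbb{R}^{d\times d}$ locally integrable, and $\mathcal{U}=\{\xi\in L^\infty(\mathbb{R},\mathbb{R}^d):\|\xi\|_\infty\le1\}$. $\Psi(t,s)$ is the principal matrix solution of $\dot x=L(t)x$ at $s$ (i.e. $\Psi(s,s)=I$). Exponential stability means: there are $K\ge1$, $\gamma>0$ with $\|\Psi(t,s)\|\le Ke^{-\gamma(t-s)}$ for all $t\ge s$. *)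

theory Defs
  imports "HOL-Analysis.Analysis" "HOL-Probability.Essential_Supremum"
begin

definition locally_integrable :: "(real \<Rightarrow> 'a::euclidean_space) \<Rightarrow> bool" where
  "locally_integrable f \<longleftrightarrow> (\<forall>K. compact K \<longrightarrow> f absolutely_integrable_on K)"

text \<open>A finite disjoint family of intervals is encoded as the set of its pairs of endpoints
  (the intervals are nonempty and disjoint, hence pairwise distinct).\<close>

definition locally_abs_continuous :: "(real \<Rightarrow> 'a::real_normed_vector) \<Rightarrow> bool" where
  "locally_abs_continuous f \<longleftrightarrow>
     (\<forall>a b. \<forall>\<epsilon>>0. \<exists>\<delta>>0. \<forall>D.
        finite D \<and> (\<forall>(u, v)\<in>D. a \<le> u \<and> u < v \<and> v \<le> b) \<and>
        disjoint_family_on (\<lambda>(u, v). {u<..<v}) D \<and> (\<Sum>(u, v)\<in>D. v - u) < \<delta>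
        \<longrightarrow> (\<Sum>(u, v)\<in>D. norm (f v - f u)) < \<epsilon>)"

text \<open>Since \<open>L\<close> is only locally integrable, solutions of \<open>x' = L(t) x\<close> are understood in
  the sense of Caratheodory: locally absolutely continuous functions that satisfy the equation
  for almost all times. The time \<open>t\<close> may lie before or after \<open>s\<close>.\<close>

definition principal_matrix_solution ::
    "(real \<Rightarrow> real ^ 'd ^ 'd) \<Rightarrow> (real \<Rightarrow> real \<Rightarrow> real ^ 'd ^ 'd) \<Rightarrow> bool" where
  "principal_matrix_solution L \<Psi> \<longleftrightarrow>
     (\<forall>s. \<Psi> s s = mat 1 \<and> locally_abs_continuous (\<lambda>t. \<Psi> t s) \<and>
          (AE t in lebesgue. ((\<lambda>t. \<Psi> t s) has_vector_derivative L t ** \<Psi> t s) (at t)))"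

text \<open>The matrix norm is the one induced by the Euclidean norm; the library's \<open>norm\<close> on
  matrices is the Frobenius norm.\<close>

definition exponentially_stable :: "(real \<Rightarrow> real \<Rightarrow> real ^ 'd ^ 'd) \<Rightarrow> bool" where
  "exponentially_stable \<Psi> \<longleftrightarrow>
     (\<exists>K \<gamma>. K \<ge> 1 \<and> \<gamma> > 0 \<and>
        (\<forall>t s. t \<ge> s \<longrightarrow> onorm ((*v) (\<Psi> t s)) \<le> K * exp (- \<gamma> * (t - s))))"

text \<open>Elements of \<open>L\<^sup>\<infinity>\<close> are represented by Lebesgue measurable functions.\<close>

definition admissible :: "(real \<Rightarrow> real ^ 'd) set" where
  "admissible = {\<xi>. \<xi> \<in> borel_measurable lebesgue \<and>
                    esssup lebesgue (\<lambda>t. ereal (norm (\<xi> t))) \<le> 1}"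

definition fibre ::
    "real \<Rightarrow> (real \<Rightarrow> real \<Rightarrow> real ^ 'd ^ 'd) \<Rightarrow> real \<Rightarrow> (real ^ 'd) set" where
  "fibre \<rho> \<Psi> t = {\<rho> *\<^sub>R (LINT s:{..t}|lebesgue. \<Psi> t s *v \<xi> s) | \<xi>. \<xi> \<in> admissible}"

definition fibrewise_closed :: "(real \<Rightarrow> 'a::topological_space set) \<Rightarrow> bool" where
  "fibrewise_closed A \<longleftrightarrow> (\<forall>t. closed (A t))"

end

theory Submission
  imports Defs
begin

text \<open>The fibre is \<open>\<rho>\<close> times the image of the unit ball of \<open>L\<^sup>\<infinity>\<close> under \<open>\<xi> \<mapsto> \<integral> G(s) \<xi>(s) ds\<close>
  with the integrable kernel \<open>G(s) = 1\<^bsub>s \<le> t\<^esub> \<Psi>(t,s)\<close>. Instead of weak-* compactness, a Hilbert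
  space argument is used: for \<open>y\<close> in the closure of this image, the sets \<open>C\<^sub>n\<close> of those \<open>\<xi>\<close> whose
  integral has distance at most \<open>1/(n+1)\<close> to \<open>y\<close> are convex and decreasing, so by the
  parallelogram identity almost minimal elements of \<open>C\<^sub>n\<close> for the weighted \<open>L\<^sup>2\<close> norm form a
  Cauchy sequence. A subsequence converges almost everywhere, and dominated convergence identifies
  the integral of its limit as \<open>y\<close>. Measurability of \<open>s \<mapsto> \<Psi>(t,s)\<close> has to be proved: uniqueness
  of Caratheodory solutions makes \<open>\<Psi>(t,s)\<close> the inverse of \<open>\<Psi>(s,t)\<close>, which is continuous in
  \<open>s\<close>.\<close>

section \<open>Locally absolutely continuous functions: integral of the derivative,
  continuity\<close>

text \<open>In a fine tagged division, the intervals tagged outside the exceptional null set are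
  controlled by the derivative; those tagged inside it lie in an open set of small measure, and
  absolute continuity makes their contribution small.\<close>

lemma locally_abs_continuous_FTC:
  fixes f :: "real \<Rightarrow> 'a::banach"
  assumes ac: "locally_abs_continuous f"
    and deriv: "AE t in lebesgue. (f has_vector_derivative f' t) (at t)"
    and "a \<le> b"
  shows "(f' has_integral f b - f a) {a..b}"
proof -
  obtain N where N: "N \<in> null_sets lebesgue"
    and f': "\<And>t. t \<notin> N \<Longrightarrow> (f has_vector_derivative f' t) (at t)"
    using AE_E3[OF deriv] by (auto simp: space_completion)
  \<comment> \<open>Zeroing the integrand on \<open>N\<close> leaves the integral unchanged (undone
    by \<open>has_integral_spike\<close> at the end), and a term tagged in \<open>N\<close> then
    consists of an increment of \<open>f\<close> alone.\<close>
  define g where "g = (\<lambda>t. if t \<in> N then 0 else f' t)"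
  have "(g has_integral f b - f a) {a..b}"
    unfolding has_integral_real
  proof (intro allI impI)
    fix e :: real assume "e > 0"
    \<comment> \<open>The errors tagged outside \<open>N\<close> add up to at most
      \<open>e' * (b - a)\<close>, which has to stay below \<open>e / 2\<close>; the
      \<open>+ 1\<close> covers the case \<open>a = b\<close>.\<close>
    define e' where "e' = e / (2 * (b - a + 1))"
    have "e' > 0" using \<open>e > 0\<close> \<open>a \<le> b\<close> by (simp add: e'_def)
    have "e' * (b - a) < e / 2"
      using \<open>e > 0\<close> \<open>a \<le> b\<close> by (simp add: e'_def field_simps)
    have "e / 2 > 0" using \<open>e > 0\<close> by simp
    then obtain \<delta> where "\<delta> > 0" and \<delta>: "\<forall>D. finite D \<and> (\<forall>(u, v)\<in>D. a \<le> u \<and> u < v \<and> v \<le> b) \<and>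
        disjoint_family_on (\<lambda>(u, v). {u<..<v}) D \<and> (\<Sum>(u, v)\<in>D. v - u) < \<delta> \<longrightarrow>
        (\<Sum>(u, v)\<in>D. norm (f v - f u)) < e / 2"
      using ac unfolding locally_abs_continuous_def by blast
    obtain T where T: "open T" "N \<subseteq> T" "emeasure lebesgue (T - N) < ennreal \<delta>"
      using sets_lebesgue_outer_open[of N \<delta>] N \<open>\<delta> > 0\<close> by blast
    have emT: "emeasure lebesgue T < ennreal \<delta>"
      using T N by (metis borel_open emeasure_Diff_null_set sets_completionI_sets sets_lborel)
    then have Tm: "T \<in> lmeasurable"
      using T(1) by (simp add: fmeasurableI borel_open order_less_trans)
    have mT: "measure lebesgue T < \<delta>"
      using emT Tm \<open>\<delta> > 0\<close> by (simp add: emeasure_eq_measure2 ennreal_less_iff)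
    have "\<forall>x. \<exists>d>0. x \<notin> N \<longrightarrow>
         (\<forall>y. norm (y - x) < d \<longrightarrow> norm (f y - f x - (y - x) *\<^sub>R f' x) \<le> e' * norm (y - x))"
    proof
      fix x
      show "\<exists>d>0. x \<notin> N \<longrightarrow>
         (\<forall>y. norm (y - x) < d \<longrightarrow> norm (f y - f x - (y - x) *\<^sub>R f' x) \<le> e' * norm (y - x))"
      proof (cases "x \<in> N")
        case False
        with f'[of x] \<open>e' > 0\<close> show ?thesis
          unfolding has_vector_derivative_def has_derivative_at_alt by blast
      qed (auto intro: exI[of _ 1])
    qed
    then obtain d where d: "\<And>x. 0 < d x"
      "\<And>x y. x \<notin> N \<Longrightarrow> norm (y - x) < d x \<Longrightarrow>
        norm (f y - f x - (y - x) *\<^sub>R f' x) \<le> e' * norm (y - x)"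
      by metis
    \<comment> \<open>Fineness puts an interval tagged in \<open>N\<close> entirely inside
      \<open>T\<close>, and keeps any other interval within reach of the derivative estimate at its
      tag.\<close>
    define \<gamma> where "\<gamma> x = (if x \<in> N then T else ball x (d x))" for x
    have "gauge \<gamma>"
      using T d(1) by (auto simp: gauge_def \<gamma>_def)
    have bound: "norm ((\<Sum>(x, K)\<in>p. measure lborel K *\<^sub>R g x) - (f b - f a)) < e"
      if p: "p tagged_division_of {a..b}" and fine: "\<gamma> fine p" for p
    proof -
      have "finite p" using p by blast
      define R where "R = (\<lambda>(x, K). measure lborel K *\<^sub>R g x - (f (Sup K) - f (Inf K)))"
      have K: "\<exists>u v. K = {u..v} \<and> u \<le> x \<and> x \<le> v \<and> Inf K = u \<and> Sup K = v \<and> a \<le> u \<and> v \<le> b"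
        if "(x, K) \<in> p" for x K
      proof -
        obtain u v where "K = cbox u v" using p \<open>(x, K) \<in> p\<close> by blast
        moreover have "x \<in> K" "K \<subseteq> {a..b}" using p \<open>(x, K) \<in> p\<close> by blast+
        ultimately show ?thesis by auto
      qed
      have ba: "b - a = (\<Sum>(x,K)\<in>p. Sup K - Inf K)" "f b - f a = (\<Sum>(x,K)\<in>p. f (Sup K) - f (Inf K))"
        using additive_tagged_division_1[where f= "\<lambda>x. x"] additive_tagged_division_1[where f= f]
            \<open>a \<le> b\<close> p by auto
      define q where "q = {z \<in> p. fst z \<in> N}"
      have "(\<Sum>z\<in>p - q. norm (R z)) \<le> (\<Sum>(x, K)\<in>p - q. e' * (Sup K - Inf K))"
      proof (rule sum_mono, clarify)
        fix x K assume "(x, K) \<in> p" "(x, K) \<notin> q"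
        then have "x \<notin> N" by (simp add: q_def)
        obtain u v where uv: "K = {u..v}" "u \<le> x" "x \<le> v" "Inf K = u" "Sup K = v"
          using K[OF \<open>(x, K) \<in> p\<close>] by blast
        have "K \<subseteq> ball x (d x)"
          using fineD[OF fine \<open>(x, K) \<in> p\<close>] \<open>x \<notin> N\<close> by (simp add: \<gamma>_def)
        moreover have "u \<in> K" "v \<in> K" using uv by auto
        ultimately have uvd: "norm (u - x) < d x" "norm (v - x) < d x"
          by (auto simp: dist_norm norm_minus_commute)
        \<comment> \<open>The estimate is applied at both endpoints. As the tag lies between them,
          \<open>norm (u - x) + norm (v - x)\<close> is exactly the length of
          \<open>K\<close>.\<close>
        have "R (x, K) = (f u - f x - (u - x) *\<^sub>R f' x) - (f v - f x - (v - x) *\<^sub>R f' x)"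
          using uv \<open>x \<notin> N\<close> by (simp add: R_def g_def algebra_simps)
        then have "norm (R (x, K)) \<le> e' * norm (u - x) + e' * norm (v - x)"
          using d(2)[OF \<open>x \<notin> N\<close> uvd(1)] d(2)[OF \<open>x \<notin> N\<close> uvd(2)]
          by (smt (verit) norm_triangle_ineq4)
        also have "\<dots> = e' * (Sup K - Inf K)"
          using uv by (simp add: algebra_simps)
        finally show "norm (R (x, K)) \<le> e' * (Sup K - Inf K)" .
      qed
      also have "\<dots> \<le> (\<Sum>(x, K)\<in>p. e' * (Sup K - Inf K))"
        using \<open>finite p\<close> \<open>e' > 0\<close> by (intro sum_mono2) (auto dest!: K)
      also have "\<dots> = e' * (b - a)"
        by (simp add: ba(1) sum_distrib_left split_def)
      finally have off: "(\<Sum>z\<in>p - q. norm (R z)) < e / 2"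
        using \<open>e' * (b - a) < e / 2\<close> by simp
      \<comment> \<open>Absolute continuity speaks of intervals with \<open>u < v\<close>, so
        degenerate ones are removed; their increment is 0.\<close>
      define q' where "q' = {(x, K) \<in> q. Inf K < Sup K}"
      define ends where "ends = (\<lambda>(x :: real, K :: real set). (Inf K, Sup K))"
      define D where "D = ends ` q'"
      have "q' \<subseteq> q" "q \<subseteq> p" by (auto simp: q'_def q_def)
      then have fin: "finite q" "finite q'"
        using \<open>finite p\<close> by (auto intro: finite_subset)
      have disj: "{Inf K<..<Sup K} \<inter> {Inf K'<..<Sup K'} = {}"
        if "(x, K) \<in> q'" "(x', K') \<in> q'" "(x, K) \<noteq> (x', K')" for x K x' K'
      proof -
        have in_p: "(x, K) \<in> p" "(x', K') \<in> p" using that \<open>q' \<subseteq> q\<close> \<open>q \<subseteq> p\<close> by auto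
        then have "interior K \<inter> interior K' = {}"
          using p that(3) by (metis tagged_division_ofD(5))
        then show ?thesis
          using K[OF in_p(1)] K[OF in_p(2)] by (metis interior_atLeastAtMost_real)
      qed
      \<comment> \<open>Equal endpoints would make two nonempty open intervals overlap. Hence
        passing to the set \<open>D\<close> of endpoint pairs merges no summands.\<close>
      have inj: "inj_on ends q'"
      proof (rule inj_onI, clarify)
        fix x K x' K' assume *: "(x, K) \<in> q'" "(x', K') \<in> q'" "ends (x, K) = ends (x', K')"
        then have "{Inf K<..<Sup K} \<inter> {Inf K'<..<Sup K'} \<noteq> {}"
          by (auto simp: ends_def q'_def)
        then show "x = x' \<and> K = K'" using disj[OF *(1,2)] by blast
      qed
      have "(\<Sum>z\<in>q. norm (R z)) = (\<Sum>(x, K)\<in>q. norm (f (Sup K) - f (Inf K)))"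
        by (rule sum.cong) (auto simp: R_def g_def q_def norm_minus_commute)
      also have "\<dots> = (\<Sum>(x, K)\<in>q'. norm (f (Sup K) - f (Inf K)))"
      proof (rule sum.mono_neutral_right[OF fin(1) \<open>q' \<subseteq> q\<close>], clarify)
        fix x K assume "(x, K) \<in> q" "(x, K) \<notin> q'"
        then have "Sup K \<le> Inf K" "(x, K) \<in> p" by (auto simp: q_def q'_def)
        then have "Sup K = Inf K" using K[of x K] by auto
        then show "norm (f (Sup K) - f (Inf K)) = 0" by simp
      qed
      also have "\<dots> = (\<Sum>(u, v)\<in>D. norm (f v - f u))"
        unfolding D_def sum.reindex[OF inj] by (simp add: ends_def split_def)
      also have "\<dots> < e / 2"
      proof (rule \<delta>[rule_format], intro conjI)
        show "finite D" using fin by (simp add: D_def)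
        show "\<forall>(u, v)\<in>D. a \<le> u \<and> u < v \<and> v \<le> b"
          using \<open>q' \<subseteq> q\<close> \<open>q \<subseteq> p\<close> K by (fastforce simp: D_def ends_def q'_def)
        show dD: "disjoint_family_on (\<lambda>(u, v). {u<..<v}) D"
          unfolding disjoint_family_on_def D_def ends_def using disj by force
        \<comment> \<open>The total length is the measure of a disjoint union contained in
          \<open>T\<close>, hence less than \<delta>.\<close>
        have "(\<Sum>(u, v)\<in>D. v - u) = (\<Sum>w\<in>D. measure lebesgue (case w of (u, v) \<Rightarrow> {u<..<v}))"
          by (rule sum.cong) (auto simp: D_def ends_def q'_def)
        also have "\<dots> = measure lebesgue (\<Union>w\<in>D. case w of (u, v) \<Rightarrow> {u<..<v})"
        proof (rule measure_finite_Union[symmetric, OF \<open>finite D\<close> _ dD])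
          fix w assume "w \<in> D"
          then obtain u v where "w = (u, v)" "u \<le> v"
            by (force simp: D_def ends_def q'_def)
          then show "emeasure lebesgue (case w of (u, v) \<Rightarrow> {u<..<v}) \<noteq> \<infinity>" by simp
        qed auto
        also have "\<dots> \<le> measure lebesgue T"
        proof (rule measure_mono_fmeasurable[OF _ _ Tm])
          show "(\<Union>w\<in>D. case w of (u, v) \<Rightarrow> {u<..<v}) \<subseteq> T"
          proof (clarsimp simp: D_def ends_def)
            fix x K y assume "(x, K) \<in> q'" "Inf K < y" "y < Sup K"
            then have "(x, K) \<in> p" "x \<in> N" by (auto simp: q'_def q_def)
            then have "K \<subseteq> T" using fineD[OF fine, of x K] by (simp add: \<gamma>_def)
            moreover obtain u v where "K = {u..v}" "Inf K = u" "Sup K = v"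
              using K[OF \<open>(x, K) \<in> p\<close>] by blast
            then have "y \<in> K" using \<open>Inf K < y\<close> \<open>y < Sup K\<close> by (metis atLeastAtMost_iff less_imp_le)
            ultimately show "y \<in> T" by blast
          qed
          show "(\<Union>w\<in>D. case w of (u, v) \<Rightarrow> {u<..<v}) \<in> sets lebesgue"
            using \<open>finite D\<close> by (intro sets.finite_UN) (auto split: prod.split)
        qed
        finally show "(\<Sum>(u, v)\<in>D. v - u) < \<delta>" using mT by simp
      qed
      finally have on: "(\<Sum>z\<in>q. norm (R z)) < e / 2" .
      have "(\<Sum>(x, K)\<in>p. measure lborel K *\<^sub>R g x) - (f b - f a) = (\<Sum>z\<in>p. R z)"
        by (simp add: ba(2) R_def split_def sum_subtractf)
      then have "norm ((\<Sum>(x, K)\<in>p. measure lborel K *\<^sub>R g x) - (f b - f a)) \<le> (\<Sum>z\<in>p. norm (R z))"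
        by (simp add: norm_sum)
      also have "\<dots> = (\<Sum>z\<in>p - q. norm (R z)) + (\<Sum>z\<in>q. norm (R z))"
        using \<open>finite p\<close> by (intro sum.subset_diff) (auto simp: q_def)
      finally show ?thesis using on off by simp
    qed
    show "\<exists>\<gamma>. gauge \<gamma> \<and> (\<forall>p. p tagged_division_of {a..b} \<and> \<gamma> fine p \<longrightarrow>
        norm ((\<Sum>(x, K)\<in>p. measure lborel K *\<^sub>R g x) - (f b - f a)) < e)"
      by (intro exI[of _ \<gamma>] conjI allI impI bound \<open>gauge \<gamma>\<close>) auto
  qed
  then show ?thesis
    by (rule has_integral_spike[rotated 2, where S = N])
       (use N in \<open>auto simp: g_def negligible_iff_null_sets\<close>)
qed

lemma locally_abs_continuous_continuous_on:
  fixes f :: "real \<Rightarrow> 'a::real_normed_vector"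
  assumes "locally_abs_continuous f"
  shows "continuous_on UNIV f"
proof (clarsimp simp: continuous_on_iff)
  fix x e :: real assume "e > 0"
  \<comment> \<open>Absolute continuity is local, so a window around \<open>x\<close> is fixed;
    families consisting of one interval suffice.\<close>
  then obtain \<delta> where "\<delta> > 0" and \<delta>: "\<forall>D. finite D \<and> (\<forall>(u, v)\<in>D. x - 1 \<le> u \<and> u < v \<and> v \<le> x + 1) \<and>
        disjoint_family_on (\<lambda>(u, v). {u<..<v}) D \<and> (\<Sum>(u, v)\<in>D. v - u) < \<delta> \<longrightarrow>
        (\<Sum>(u, v)\<in>D. norm (f v - f u)) < e"
    using assms unfolding locally_abs_continuous_def by blast
  have uv: "norm (f v - f u) < e" if "x - 1 \<le> u" "u < v" "v \<le> x + 1" "v - u < \<delta>" for u v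
    using \<delta>[rule_format, of "{(u, v)}"] that by (auto simp: disjoint_family_on_def)
  have "dist (f y) (f x) < e" if "dist y x < min 1 \<delta>" for y
    using that uv[of x y] uv[of y x] \<open>e > 0\<close>
    by (cases y x rule: linorder_cases) (auto simp: dist_norm norm_minus_commute)
  then show "\<exists>d>0. \<forall>y. dist y x < d \<longrightarrow> dist (f y) (f x) < e"
    using \<open>\<delta> > 0\<close> by (metis min_less_iff_conj zero_less_one)
qed

section \<open>Closedness of the set of integrals over the unit ball\<close>

text \<open>The weight \<open>norm (G x)\<close> in \<open>q\<close> makes \<open>q\<close> finite on the unit ball and is harmless:
  where \<open>G\<close> vanishes, the value of \<open>\<xi>\<close> does not matter.\<close>

lemma closed_integrals_unit_ball:
  fixes prod :: "'g::{banach,second_countable_topology} \<Rightarrow> 'b::euclidean_space \<Rightarrow> 'c::{banach,second_countable_topology}"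
  assumes bil: "bounded_bilinear prod" and G: "integrable (M :: 'a measure) G"
  shows "closed ((\<lambda>\<xi>. LINT x|M. prod (G x) (\<xi> x)) ` {\<xi> \<in> borel_measurable M. AE x in M. norm (\<xi> x) \<le> 1})"
    (is "closed (?I ` ?U)")
proof -
  interpret bounded_bilinear prod by (rule bil)
  obtain K where K: "\<And>a b. norm (prod a b) \<le> norm a * norm b * K" "K > 0"
    using pos_bounded by blast
  have Gm [measurable]: "G \<in> borel_measurable M" using G by simp
  have pm: "(\<lambda>x. prod (G x) (\<xi> x)) \<in> borel_measurable M" if "\<xi> \<in> borel_measurable M" for \<xi>
    by (rule borel_measurable_continuous_Pair[OF Gm that])
      (rule continuous_on[OF continuous_on_fst continuous_on_snd]; rule continuous_on_id)
  have dom: "AE x in M. norm (prod (G x) (\<xi> x)) \<le> K * norm (G x)" if "\<xi> \<in> ?U" for \<xi>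
  proof -
    have "AE x in M. norm (\<xi> x) \<le> 1" using that by simp
    then show ?thesis
    proof (rule AE_mp, intro AE_I2 impI)
      fix x assume "norm (\<xi> x) \<le> 1"
      then have "norm (G x) * norm (\<xi> x) * K \<le> norm (G x) * 1 * K"
        using K(2) by (intro mult_right_mono mult_left_mono) auto
      then show "norm (prod (G x) (\<xi> x)) \<le> K * norm (G x)"
        using K(1)[of "G x" "\<xi> x"] by (simp add: mult.commute)
    qed
  qed
  have int: "integrable M (\<lambda>x. prod (G x) (\<xi> x))" if "\<xi> \<in> ?U" for \<xi>
  proof (rule Bochner_Integration.integrable_bound)
    show "integrable M (\<lambda>x. K * norm (G x))" using G by simp
    show "(\<lambda>x. prod (G x) (\<xi> x)) \<in> borel_measurable M" using that by (intro pm) simp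
    show "AE x in M. norm (prod (G x) (\<xi> x)) \<le> norm (K * norm (G x))"
      using dom[OF that] K(2) by (simp add: abs_mult)
  qed
  define q where "q \<xi> = (LINT x|M. norm (G x) * (norm (\<xi> x))\<^sup>2)" for \<xi> :: "'a \<Rightarrow> 'b"
  define B where "B = (LINT x|M. norm (G x))"
  have "B \<ge> 0" by (simp add: B_def)
  have qint: "integrable M (\<lambda>x. norm (G x) * (norm (\<xi> x))\<^sup>2)" if "\<xi> \<in> ?U" for \<xi>
  proof (rule Bochner_Integration.integrable_bound[OF integrable_norm[OF G]])
    have "\<xi> \<in> borel_measurable M" "AE x in M. norm (\<xi> x) \<le> 1" using that by auto
    then show "(\<lambda>x. norm (G x) * (norm (\<xi> x))\<^sup>2) \<in> borel_measurable M"
      "AE x in M. norm (norm (G x) * (norm (\<xi> x))\<^sup>2) \<le> norm (norm (G x))"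
      by (measurable, auto elim!: eventually_mono simp: mult_left_le power_le_one)
  qed
  have q_nonneg: "q \<xi> \<ge> 0" for \<xi> by (simp add: q_def)
  have q_le: "q \<xi> \<le> B" if "\<xi> \<in> ?U" for \<xi>
    unfolding q_def B_def
  proof (rule integral_mono_AE[OF qint[OF that] integrable_norm[OF G]])
    have "AE x in M. norm (\<xi> x) \<le> 1" using that by auto
    then show "AE x in M. norm (G x) * (norm (\<xi> x))\<^sup>2 \<le> norm (G x)"
      by (auto elim!: eventually_mono simp: mult_left_le power_le_one)
  qed
  \<comment> \<open>Half the difference, unlike the difference itself, stays in the unit ball, so
    the integrability of \<open>qint\<close> applies to it as well.\<close>
  define mid where "mid \<xi> \<eta> = (\<lambda>x. (1/2) *\<^sub>R (\<xi> x + \<eta> x))" for \<xi> \<eta> :: "'a \<Rightarrow> 'b"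
  define hdiff where "hdiff \<xi> \<eta> = (\<lambda>x. (1/2) *\<^sub>R (\<xi> x - \<eta> x))" for \<xi> \<eta> :: "'a \<Rightarrow> 'b"
  have mid: "mid \<xi> \<eta> \<in> ?U" "hdiff \<xi> \<eta> \<in> ?U" if "\<xi> \<in> ?U" "\<eta> \<in> ?U" for \<xi> \<eta>
  proof -
    have [measurable]: "\<xi> \<in> borel_measurable M" "\<eta> \<in> borel_measurable M" using that by auto
    have ae: "AE x in M. norm (\<xi> x) \<le> 1" "AE x in M. norm (\<eta> x) \<le> 1" using that by auto
    have *: "norm ((1/2) *\<^sub>R (u + v)) \<le> 1" "norm ((1/2) *\<^sub>R (u - v)) \<le> 1"
      if "norm u \<le> 1" "norm v \<le> 1" for u v :: 'b
      using that norm_triangle_ineq[of u v] norm_triangle_ineq4[of u v] by auto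
    have "AE x in M. norm (mid \<xi> \<eta> x) \<le> 1" "AE x in M. norm (hdiff \<xi> \<eta> x) \<le> 1"
      using ae by (eventually_elim, simp only: mid_def hdiff_def * simp_thms)+
    then show "mid \<xi> \<eta> \<in> ?U" "hdiff \<xi> \<eta> \<in> ?U" by (auto simp: mid_def hdiff_def)
  qed
  have I_mid: "?I (mid \<xi> \<eta>) = (1/2) *\<^sub>R (?I \<xi> + ?I \<eta>)" if "\<xi> \<in> ?U" "\<eta> \<in> ?U" for \<xi> \<eta>
    using int[OF that(1)] int[OF that(2)] by (simp add: mid_def add_right scaleR_right)
  have parallelogram: "4 * q (hdiff \<xi> \<eta>) = 2 * q \<xi> + 2 * q \<eta> - 4 * q (mid \<xi> \<eta>)" if "\<xi> \<in> ?U" "\<eta> \<in> ?U" for \<xi> \<eta>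
  proof -
    note i = qint[OF that(1)] qint[OF that(2)] qint[OF mid(1)[OF that]] qint[OF mid(2)[OF that]]
    have "4 * (norm (G x) * (norm (hdiff \<xi> \<eta> x))\<^sup>2) + 4 * (norm (G x) * (norm (mid \<xi> \<eta> x))\<^sup>2)
      = 2 * (norm (G x) * (norm (\<xi> x))\<^sup>2) + 2 * (norm (G x) * (norm (\<eta> x))\<^sup>2)" for x
      by (simp add: mid_def hdiff_def power2_norm_eq_inner inner_add_left inner_add_right inner_diff_left
          inner_diff_right algebra_simps)
    then have "(LINT x|M. 4 * (norm (G x) * (norm (hdiff \<xi> \<eta> x))\<^sup>2) + 4 * (norm (G x) * (norm (mid \<xi> \<eta> x))\<^sup>2))
      = (LINT x|M. 2 * (norm (G x) * (norm (\<xi> x))\<^sup>2) + 2 * (norm (G x) * (norm (\<eta> x))\<^sup>2))"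
      by simp
    then show ?thesis
      using i unfolding q_def by simp
  qed
  have "y \<in> ?I ` ?U" if y: "y \<in> closure (?I ` ?U)" for y
  proof -
    define C where "C n = {\<xi> \<in> ?U. norm (?I \<xi> - y) \<le> inverse (real (Suc n))}" for n
    have C_U: "C n \<subseteq> ?U" for n by (auto simp: C_def)
    have C_ne: "C n \<noteq> {}" for n
    proof -
      have "inverse (real (Suc n)) > 0" by simp
      then obtain \<xi> where "\<xi> \<in> ?U" "dist (?I \<xi>) y < inverse (real (Suc n))"
        using y unfolding closure_approachable by blast
      then show ?thesis by (auto simp: C_def dist_norm)
    qed
    have C_anti: "C m \<subseteq> C n" if "n \<le> m" for m n
    proof -
      have "inverse (real (Suc m)) \<le> inverse (real (Suc n))" using that by simp
      from order_trans[OF _ this] show ?thesis unfolding C_def by blast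
    qed
    have C_mid: "mid \<xi> \<eta> \<in> C n" if "\<xi> \<in> C n" "\<eta> \<in> C n" for \<xi> \<eta> n
    proof -
      have U: "\<xi> \<in> ?U" "\<eta> \<in> ?U" using that C_U by auto
      have "?I (mid \<xi> \<eta>) - y = (1/2) *\<^sub>R ((?I \<xi> - y) + (?I \<eta> - y))"
        unfolding I_mid[OF U] by (simp add: algebra_simps flip: scaleR_add_left)
      also have "norm \<dots> \<le> (1/2) * (norm (?I \<xi> - y) + norm (?I \<eta> - y))"
        by (simp add: norm_triangle_ineq)
      also have "\<dots> \<le> inverse (real (Suc n))"
        using that by (auto simp: C_def)
      finally show ?thesis using mid(1)[OF U] by (simp add: C_def)
    qed
    define d where "d n = Inf (q ` C n)" for n
    have bdd: "bdd_below (q ` C n)" for n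
      using q_nonneg by (intro bdd_belowI[of _ 0]) auto
    have d_le: "d n \<le> q \<xi>" if "\<xi> \<in> C n" for n \<xi>
      unfolding d_def using bdd that by (intro cInf_lower) auto
    have "\<exists>\<xi>\<in>C n. q \<xi> < d n + inverse (real (Suc n))" for n
    proof -
      have "Inf (q ` C n) < d n + inverse (real (Suc n))" by (simp add: d_def)
      then show ?thesis
        using cInf_less_iff[OF _ bdd, of n] C_ne[of n] by auto
    qed
    then obtain \<xi> where \<xi>: "\<And>n. \<xi> n \<in> C n" "\<And>n. q (\<xi> n) < d n + inverse (real (Suc n))"
      by metis
    have \<xi>U: "\<xi> n \<in> ?U" for n using \<xi>(1) C_U by blast
    \<comment> \<open>Infima over shrinking sets increase, and they are bounded by
      \<open>B\<close>.\<close>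
    have "incseq d"
      unfolding d_def by (intro incseq_SucI cInf_superset_mono image_mono C_anti bdd) (use C_ne in auto)
    moreover have "d n \<le> B" for n
      using d_le[OF \<xi>(1)] q_le[OF \<xi>U] order_trans by blast
    ultimately have "Cauchy d"
      by (meson LIMSEQ_imp_Cauchy incseq_convergent)
    \<comment> \<open>The midpoint lies in the larger set \<open>C n\<close>, so its
      \<open>q\<close> is at least \<open>d n\<close>. Inserting this and the almost minimality of
      both elements into the parallelogram identity gives the bound.\<close>
    have cauchy_aux: "4 * q (hdiff (\<xi> n) (\<xi> m)) \<le> 2 * (d m - d n) + 2 * inverse (real (Suc n)) + 2 * inverse (real (Suc m))"
      if "n \<le> m" for n m
    proof -
      have "mid (\<xi> n) (\<xi> m) \<in> C n"
        using C_mid \<xi>(1) C_anti[OF that] by blast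
      then show ?thesis
        using parallelogram[OF \<xi>U[of n] \<xi>U[of m]] d_le \<xi>(2)[of n] \<xi>(2)[of m] by fastforce
    qed
    have hdiff_sym: "q (hdiff \<xi> \<eta>) = q (hdiff \<eta> \<xi>)" for \<xi> \<eta>
      by (simp add: q_def hdiff_def norm_minus_commute)
    have q_cauchy: "\<exists>N. \<forall>i\<ge>N. \<forall>j\<ge>N. q (hdiff (\<xi> i) (\<xi> j)) < e" if "e > 0" for e
    proof -
      obtain N1 where N1: "\<And>i j. i \<ge> N1 \<Longrightarrow> j \<ge> N1 \<Longrightarrow> norm (d i - d j) < e / 2"
        using CauchyD[OF \<open>Cauchy d\<close>, of "e / 2"] \<open>e > 0\<close> by auto
      obtain N2 where N2: "inverse (real (Suc N2)) < e / 2"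
        using reals_Archimedean[of "e / 2"] \<open>e > 0\<close> by auto
      have inv: "inverse (real (Suc n)) < e / 2" if "n \<ge> N2" for n
      proof -
        have "inverse (real (Suc n)) \<le> inverse (real (Suc N2))" using that by simp
        also note N2
        finally show ?thesis .
      qed
      have le: "q (hdiff (\<xi> i) (\<xi> j)) < e" if "i \<ge> max N1 N2" "i \<le> j" for i j
      proof -
        have "d j - d i < e / 2"
          using N1[of j i] abs_ge_self[of "d j - d i"] that by simp
        moreover have "inverse (real (Suc i)) < e / 2" "inverse (real (Suc j)) < e / 2"
          using inv that by auto
        moreover have "t < e" if "4 * t \<le> 2 * u + 2 * v + 2 * w" "u < e / 2" "v < e / 2" "w < e / 2"
          for t u v w
          using that \<open>e > 0\<close> by simp
        ultimately show ?thesis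
          using cauchy_aux[OF that(2)] by blast
      qed
      have "q (hdiff (\<xi> i) (\<xi> j)) < e" if "i \<ge> max N1 N2" "j \<ge> max N1 N2" for i j
        using le[of i j] le[of j i] hdiff_sym[of "\<xi> i" "\<xi> j"] that by (cases "i \<le> j") auto
      then show ?thesis by blast
    qed
    \<comment> \<open>The weight turns closeness in \<open>q\<close> into closeness in
      \<open>L^1\<close>, for which an almost everywhere Cauchy subsequence is available.\<close>
    define s where "s n x = norm (G x) *\<^sub>R \<xi> n x" for n x
    have s_int: "integrable M (s n)" for n
    proof (rule Bochner_Integration.integrable_bound[OF integrable_norm[OF G]])
      have "\<xi> n \<in> borel_measurable M" "AE x in M. norm (\<xi> n x) \<le> 1" using \<xi>U[of n] by auto
      then show "s n \<in> borel_measurable M" "AE x in M. norm (s n x) \<le> norm (norm (G x))"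
        unfolding s_def by (measurable, auto elim!: eventually_mono simp: mult_left_le)
    qed
    have s_cauchy: "\<exists>N. \<forall>i\<ge>N. \<forall>j\<ge>N. (LINT x|M. norm (s i x - s j x)) < e" if "e > 0" for e
    proof -
      \<comment> \<open>The \<open>L^1\<close> distance will be bounded by \<open>2 * \<epsilon> * B
        + (2 / \<epsilon>) * q (hdiff (\<xi> i) (\<xi> j))\<close>. This \<epsilon> makes the first
        term at most \<open>e / 2\<close>, and \<open>q\<close> below
        \<open>\<epsilon> * e / 4\<close> makes the second one smaller than
        \<open>e / 2\<close>.\<close>
      define \<epsilon> where "\<epsilon> = e / (4 * (B + 1))"
      have "\<epsilon> > 0" using \<open>e > 0\<close> \<open>B \<ge> 0\<close> by (simp add: \<epsilon>_def)
      have "2 * \<epsilon> * B \<le> e / 2"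
        using \<open>e > 0\<close> \<open>B \<ge> 0\<close> by (simp add: \<epsilon>_def field_simps)
      obtain N where N: "\<And>i j. i \<ge> N \<Longrightarrow> j \<ge> N \<Longrightarrow> q (hdiff (\<xi> i) (\<xi> j)) < \<epsilon> * e / 4"
        using q_cauchy[of "\<epsilon> * e / 4"] \<open>e > 0\<close> \<open>\<epsilon> > 0\<close> by auto
      have "(LINT x|M. norm (s i x - s j x)) < e" if "i \<ge> N" "j \<ge> N" for i j
      proof -
        \<comment> \<open>Takes the place of the Cauchy-Schwarz inequality: a pointwise bound of the
          first power by the square, valid for every positive \<epsilon>.\<close>
        have amgm: "t \<le> \<epsilon> + t\<^sup>2 / \<epsilon>" if "t \<ge> 0" for t
        proof (cases "t \<le> \<epsilon>")
          case True then show ?thesis using \<open>\<epsilon> > 0\<close> by (simp add: add_increasing2)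
        next
          case False
          then have "t * \<epsilon> \<le> t * t" using that by (intro mult_left_mono) auto
          then have "t \<le> t\<^sup>2 / \<epsilon>" using \<open>\<epsilon> > 0\<close> by (simp add: pos_le_divide_eq power2_eq_square)
          then show ?thesis using \<open>\<epsilon> > 0\<close> by simp
        qed
        have pt: "norm (s i x - s j x) \<le> 2 * \<epsilon> * norm (G x) + (2 / \<epsilon>) * (norm (G x) * (norm (hdiff (\<xi> i) (\<xi> j) x))\<^sup>2)" for x
        proof -
          have "norm (s i x - s j x) = 2 * norm (G x) * norm (hdiff (\<xi> i) (\<xi> j) x)"
            by (simp add: s_def hdiff_def flip: scaleR_diff_right)
          also have "\<dots> \<le> 2 * norm (G x) * (\<epsilon> + (norm (hdiff (\<xi> i) (\<xi> j) x))\<^sup>2 / \<epsilon>)"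
            by (intro mult_left_mono amgm) auto
          finally show ?thesis by (simp add: algebra_simps)
        qed
        have "(LINT x|M. norm (s i x - s j x)) \<le>
          (LINT x|M. 2 * \<epsilon> * norm (G x) + (2 / \<epsilon>) * (norm (G x) * (norm (hdiff (\<xi> i) (\<xi> j) x))\<^sup>2))"
          by (intro integral_mono pt Bochner_Integration.integrable_add Bochner_Integration.integrable_diff
              integrable_mult_right integrable_norm s_int G qint[OF mid(2)[OF \<xi>U \<xi>U]])
        also have "\<dots> = 2 * \<epsilon> * B + (2 / \<epsilon>) * q (hdiff (\<xi> i) (\<xi> j))"
          unfolding B_def q_def using G qint[OF mid(2)[OF \<xi>U[of i] \<xi>U[of j]]] by simp
        also have "\<dots> < e / 2 + (2 / \<epsilon>) * (\<epsilon> * e / 4)"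
          using \<open>2 * \<epsilon> * B \<le> e / 2\<close> N[OF that] \<open>\<epsilon> > 0\<close>
          by (intro add_le_less_mono mult_strict_left_mono) auto
        also have "\<dots> = e" using \<open>\<epsilon> > 0\<close> by simp
        finally show ?thesis .
      qed
      then show ?thesis by blast
    qed
    obtain r where r: "strict_mono r" and ae_cauchy: "AE x in M. Cauchy (\<lambda>i. s (r i) x)"
      using cauchy_L1_AE_cauchy_subseq[OF s_int s_cauchy] by blast
    \<comment> \<open>Where \<open>G\<close> vanishes, \<open>s\<close> carries no information about
      \<open>\<xi>\<close>. The value 0 there makes the sequence converge wherever \<open>s\<close>
      is Cauchy and does not affect the product with \<open>G\<close>.\<close>
    define h where "h n x = (if G x = 0 then 0 else \<xi> (r n) x)" for n x
    define \<zeta> where "\<zeta> x = lim (\<lambda>n. h n x)" for x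
    have h_meas: "h n \<in> borel_measurable M" for n
    proof -
      have [measurable]: "\<xi> (r n) \<in> borel_measurable M" using \<xi>U[of "r n"] by simp
      show ?thesis unfolding h_def by measurable
    qed
    have \<zeta>m: "\<zeta> \<in> borel_measurable M"
      unfolding \<zeta>_def using h_meas by (rule borel_measurable_lim_metric)
    have lim: "AE x in M. (\<lambda>n. h n x) \<longlonglongrightarrow> \<zeta> x"
      using ae_cauchy
    proof eventually_elim
      fix x assume cau: "Cauchy (\<lambda>i. s (r i) x)"
      have "convergent (\<lambda>n. h n x)"
      proof (cases "G x = 0")
        case False
        obtain l where "(\<lambda>i. s (r i) x) \<longlonglongrightarrow> l"
          using cau Cauchy_convergent convergent_def by blast
        then have "(\<lambda>i. inverse (norm (G x)) *\<^sub>R s (r i) x) \<longlonglongrightarrow> inverse (norm (G x)) *\<^sub>R l"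
          by (intro tendsto_intros)
        then show ?thesis using False by (auto simp: h_def s_def convergent_def)
      qed (simp add: h_def convergent_const)
      then show "(\<lambda>n. h n x) \<longlonglongrightarrow> \<zeta> x"
        by (simp add: \<zeta>_def convergent_LIMSEQ_iff)
    qed
    have "AE x in M. \<forall>n. norm (\<xi> n x) \<le> 1"
      using \<xi>U by (simp add: AE_all_countable)
    with lim have "AE x in M. norm (\<zeta> x) \<le> 1"
    proof eventually_elim
      fix x assume "\<forall>n. norm (\<xi> n x) \<le> 1" "(\<lambda>n. h n x) \<longlonglongrightarrow> \<zeta> x"
      then show "norm (\<zeta> x) \<le> 1"
        by (intro LIMSEQ_le_const2[OF tendsto_norm]) (auto simp: h_def)
    qed
    with \<zeta>m have \<zeta>U: "\<zeta> \<in> ?U" by simp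
    have "(\<lambda>n. ?I (\<xi> (r n))) \<longlonglongrightarrow> ?I \<zeta>"
    proof (rule integral_dominated_convergence)
      show "integrable M (\<lambda>x. K * norm (G x))" using G by simp
      show "(\<lambda>x. prod (G x) (\<zeta> x)) \<in> borel_measurable M" using pm \<zeta>m .
      show "(\<lambda>x. prod (G x) (\<xi> (r n) x)) \<in> borel_measurable M" for n using pm \<xi>U by blast
      show "AE x in M. norm (prod (G x) (\<xi> (r n) x)) \<le> K * norm (G x)" for n using dom \<xi>U .
      show "AE x in M. (\<lambda>n. prod (G x) (\<xi> (r n) x)) \<longlonglongrightarrow> prod (G x) (\<zeta> x)"
        using lim
      proof eventually_elim
        fix x assume "(\<lambda>n. h n x) \<longlonglongrightarrow> \<zeta> x"
        then have "(\<lambda>n. prod (G x) (h n x)) \<longlonglongrightarrow> prod (G x) (\<zeta> x)"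
          by (intro tendsto tendsto_const)
        moreover have "prod (G x) (h n x) = prod (G x) (\<xi> (r n) x)" for n
          by (simp add: h_def zero_left)
        ultimately show "(\<lambda>n. prod (G x) (\<xi> (r n) x)) \<longlonglongrightarrow> prod (G x) (\<zeta> x)" by simp
      qed
    qed
    moreover have "(\<lambda>n. ?I (\<xi> n)) \<longlonglongrightarrow> y"
      by (rule LIM_zero_cancel, rule Lim_null_comparison[OF _ LIMSEQ_inverse_real_of_nat])
        (use \<xi>(1) in \<open>simp add: C_def\<close>)
    then have "(\<lambda>n. ?I (\<xi> (r n))) \<longlonglongrightarrow> y"
      using LIMSEQ_subseq_LIMSEQ[OF _ r] by (auto simp: o_def)
    ultimately have "?I \<zeta> = y" by (rule LIMSEQ_unique)
    then show ?thesis using \<zeta>U by blast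
  qed
  then have "closure (?I ` ?U) \<subseteq> ?I ` ?U" by (rule subsetI)
  then show ?thesis by (simp only: closure_subset_eq)
qed

section \<open>Uniqueness for linear equations and inversion of the principal matrix
  solution\<close>

lemma bounded_bilinear_matrix_vector_mult:
  "bounded_bilinear ((*v) :: real^'n^'m \<Rightarrow> real^'n \<Rightarrow> real^'m)"
  unfolding bilinear_conv_bounded_bilinear[symmetric] bilinear_def
  by (auto intro!: linearI simp: matrix_vector_right_distrib matrix_vector_mult_add_rdistrib
      scaleR_matrix_vector_assoc matrix_vector_mult_scaleR)

text \<open>The zero set is closed by continuity and open because on a short interval \<open>J\<close> around a
  zero the equation halves the maximum of \<open>norm z\<close>.\<close>

lemma linear_integral_equation_eq_0:
  fixes prod :: "'g::euclidean_space \<Rightarrow> 'b::euclidean_space \<Rightarrow> 'b"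
  assumes bil: "bounded_bilinear prod" and L: "locally_integrable L"
    and cont: "continuous_on UNIV z"
    and eq: "\<And>a b. a \<le> b \<Longrightarrow> ((\<lambda>t. prod (L t) (z t)) has_integral z b - z a) {a..b}"
    and "z s = 0"
  shows "z t = 0"
proof -
  obtain K where K: "\<And>a b. norm (prod a b) \<le> norm a * norm b * K" "K > 0"
    using bounded_bilinear.pos_bounded[OF bil] by blast
  have L_int: "(\<lambda>t. norm (L t)) integrable_on {a..b}" for a b
    using L unfolding locally_integrable_def by (simp add: absolutely_integrable_on_def)
  define Z where "Z = {t. z t = 0}"
  have "closed Z"
    unfolding Z_def using cont continuous_closed_preimage_constant[of UNIV z 0] by simp
  have "\<exists>h>0. ball t0 h \<subseteq> Z" if "t0 \<in> Z" for t0
  proof -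
    \<comment> \<open>Continuity of this primitive yields an interval \<open>J\<close> around
      \<open>t0\<close> on which \<open>norm (L t)\<close> has integral at most
      \<open>1 / (2 * K)\<close>.\<close>
    define F where "F x = integral {t0 - 1..x} (\<lambda>t. norm (L t))" for x
    have "continuous_on {t0 - 1..t0 + 1} F"
      unfolding F_def using L_int by (rule indefinite_integral_continuous_1)
    moreover have "1 / (4 * K) > 0" using K(2) by simp
    ultimately obtain d where "d > 0"
      and d: "\<And>x. x \<in> {t0 - 1..t0 + 1} \<Longrightarrow> dist x t0 < d \<Longrightarrow> dist (F x) (F t0) < 1 / (4 * K)"
      unfolding continuous_on_iff by (metis atLeastAtMost_iff diff_le_eq le_add_same_cancel1 zero_le_one)
    \<comment> \<open>Keeps the endpoints of \<open>J\<close> inside the window where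
      \<open>F\<close> is continuous and closer than \<open>d\<close> to \<open>t0\<close>.\<close>
    define h where "h = min 1 d / 2"
    have h: "0 < h" "h < 1" "h < d" using \<open>d > 0\<close> by (auto simp: h_def)
    define J where "J = {t0 - h..t0 + h}"
    have "F (t0 - h) + integral J (\<lambda>t. norm (L t)) = F (t0 + h)"
      unfolding F_def J_def using h L_int
      by (intro Henstock_Kurzweil_Integration.integral_combine) auto
    moreover have "dist (F (t0 - h)) (F t0) < 1 / (4 * K)" "dist (F (t0 + h)) (F t0) < 1 / (4 * K)"
      using d[of "t0 - h"] d[of "t0 + h"] h by (auto simp: dist_norm)
    ultimately have "integral J (\<lambda>t. norm (L t)) \<le> 1 / (4 * K) + 1 / (4 * K)"
      by (simp add: dist_real_def abs_less_iff)
    then have small: "K * integral J (\<lambda>t. norm (L t)) \<le> 1 / 2"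
      using K(2) by (simp add: field_simps)
    have "compact J" "J \<noteq> {}" using h by (auto simp: J_def)
    then obtain m where m: "m \<in> J" "\<And>x. x \<in> J \<Longrightarrow> norm (z x) \<le> norm (z m)"
      using continuous_attains_sup[of J "\<lambda>x. norm (z x)"] continuous_on_subset[OF cont]
      by (metis continuous_on_norm subset_UNIV)
    define S where "S = norm (z m)"
    have le: "norm (z b - z a) \<le> S / 2" if "a \<in> J" "b \<in> J" "a \<le> b" for a b
    proof -
      have sub: "{a..b} \<subseteq> J" using that by (auto simp: J_def)
      have "norm (z b - z a) = norm (integral {a..b} (\<lambda>t. prod (L t) (z t)))"
        using eq[OF \<open>a \<le> b\<close>] by (simp add: integral_unique)
      also have "\<dots> \<le> integral {a..b} (\<lambda>t. K * S * norm (L t))"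
      proof (rule Henstock_Kurzweil_Integration.integral_norm_bound_integral)
        show "(\<lambda>t. prod (L t) (z t)) integrable_on {a..b}" using eq[OF \<open>a \<le> b\<close>] by blast
        show "(\<lambda>t. K * S * norm (L t)) integrable_on {a..b}"
          using L_int by (rule integrable_on_mult_right)
        fix x assume "x \<in> {a..b}"
        then have "norm (L x) * norm (z x) * K \<le> norm (L x) * S * K"
          using m(2) sub K(2) unfolding S_def by (intro mult_right_mono mult_left_mono) auto
        then show "norm (prod (L x) (z x)) \<le> K * S * norm (L x)"
          using K(1)[of "L x" "z x"] by (simp add: ac_simps)
      qed
      also have "\<dots> = K * S * integral {a..b} (\<lambda>t. norm (L t))"
        by simp
      also have "\<dots> \<le> K * S * integral J (\<lambda>t. norm (L t))"
        using sub L_int K(2) unfolding J_def S_def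
        by (intro mult_left_mono integral_subset_le) auto
      also have "\<dots> = S * (K * integral J (\<lambda>t. norm (L t)))" by simp
      also have "\<dots> \<le> S * (1 / 2)"
        using small by (rule mult_left_mono) (simp add: S_def)
      finally show ?thesis by simp
    qed
    have "t0 \<in> J" "z t0 = 0" using h \<open>t0 \<in> Z\<close> by (auto simp: J_def Z_def)
    \<comment> \<open>Since \<open>z t0 = 0\<close>, \<open>S\<close> is the norm of the increment
      between \<open>t0\<close> and the maximum point \<open>m\<close>, which may lie on either side
      of \<open>t0\<close>.\<close>
    then have "S \<le> S / 2"
      using le[of t0 m] le[of m t0] m(1) by (cases "t0 \<le> m") (auto simp: S_def)
    then have "S = 0" by (simp add: S_def)
    then have "J \<subseteq> Z"
      using m(2) by (auto simp: S_def Z_def)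
    moreover have "ball t0 h \<subseteq> J" by (auto simp: J_def dist_real_def)
    ultimately show ?thesis using h by blast
  qed
  then have "open Z" by (simp add: open_contains_ball)
  with \<open>closed Z\<close> have "Z = {} \<or> Z = UNIV" using clopen by blast
  then show ?thesis using \<open>z s = 0\<close> by (auto simp: Z_def)
qed

text \<open>For each vector \<open>w\<close>, the functions
  \<open>\<Psi> \<tau> s *v (\<Psi> s t *v w)\<close> and \<open>\<Psi> \<tau> t *v w\<close> of
  \<tau> solve the same equation and agree at \<open>\<tau> = s\<close>. By uniqueness they agree at
  \<open>\<tau> = t\<close>, where the second one equals \<open>w\<close>.\<close>

lemma principal_matrix_solution_inverse:
  fixes L :: "real \<Rightarrow> real ^ 'd ^ 'd"
  assumes L: "locally_integrable L" and \<Psi>: "principal_matrix_solution L \<Psi>"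
  shows "\<Psi> t s ** \<Psi> s t = mat 1"
proof -
  interpret mv: bounded_bilinear "(*v) :: real^'d^'d \<Rightarrow> real^'d \<Rightarrow> real^'d"
    by (rule bounded_bilinear_matrix_vector_mult)
  have \<Psi>1: "\<Psi> s s = mat 1" and ac: "locally_abs_continuous (\<lambda>\<tau>. \<Psi> \<tau> s)"
    and ode: "AE \<tau> in lebesgue. ((\<lambda>\<tau>. \<Psi> \<tau> s) has_vector_derivative L \<tau> ** \<Psi> \<tau> s) (at \<tau>)" for s
    using \<Psi> by (auto simp: principal_matrix_solution_def)
  \<comment> \<open>Evaluation at \<open>w\<close> is linear and commutes with the integral, so the
    matrix equation gives an integral equation for vectors.\<close>
  have sol: "((\<lambda>\<tau>. L \<tau> *v (\<Psi> \<tau> s *v w)) has_integral \<Psi> b s *v w - \<Psi> a s *v w) {a..b}"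
    if "a \<le> b" for a b s w
    using has_integral_linear[OF locally_abs_continuous_FTC[OF ac ode that] mv.bounded_linear_left[of w]]
    by (simp add: o_def mv.diff_left matrix_vector_mul_assoc)
  have "\<Psi> t s *v (\<Psi> s t *v w) - \<Psi> t t *v w = 0" for w
  proof (rule linear_integral_equation_eq_0[OF bounded_bilinear_matrix_vector_mult L,
        where s = s and z = "\<lambda>\<tau>. \<Psi> \<tau> s *v (\<Psi> s t *v w) - \<Psi> \<tau> t *v w"])
    show "continuous_on UNIV (\<lambda>\<tau>. \<Psi> \<tau> s *v (\<Psi> s t *v w) - \<Psi> \<tau> t *v w)"
      by (intro continuous_on_diff mv.continuous_on locally_abs_continuous_continuous_on ac continuous_on_const)
    show "((\<lambda>\<tau>. L \<tau> *v (\<Psi> \<tau> s *v (\<Psi> s t *v w) - \<Psi> \<tau> t *v w)) has_integral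
        (\<Psi> b s *v (\<Psi> s t *v w) - \<Psi> b t *v w) - (\<Psi> a s *v (\<Psi> s t *v w) - \<Psi> a t *v w)) {a..b}"
      if "a \<le> b" for a b
      using has_integral_diff[OF sol[OF that, of s "\<Psi> s t *v w"] sol[OF that, of t w]]
      by (simp add: mv.diff_right algebra_simps)
  qed (simp add: \<Psi>1)
  then show ?thesis
    by (simp add: matrix_eq \<Psi>1 flip: matrix_vector_mul_assoc)
qed

section \<open>Continuity of a matrix inverse\<close>

lemma continuous_on_det:
  fixes A :: "'a::topological_space \<Rightarrow> real ^ 'n ^ 'n"
  assumes "\<And>i j. continuous_on S (\<lambda>s. A s $ i $ j)"
  shows "continuous_on S (\<lambda>s. det (A s))"
  unfolding det_def by (intro continuous_intros assms)

text \<open>By Cramer's rule the entries of \<open>Q\<close> are quotients of determinants whose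
  entries are continuous, with nonzero denominator \<open>det (P s)\<close>.\<close>

lemma continuous_on_matrix_right_inverse:
  fixes P Q :: "'a::topological_space \<Rightarrow> real ^ 'n ^ 'n"
  assumes cont: "continuous_on S P" and inv: "\<And>s. s \<in> S \<Longrightarrow> P s ** Q s = mat 1"
  shows "continuous_on S Q"
proof -
  have det_nz: "det (P s) \<noteq> 0" if "s \<in> S" for s
    using inv[OF that] by (metis invertible_det_nz invertible_right_inverse)
  have Q: "Q s $ i $ j = det (\<chi> k l. if l = i then axis j 1 $ k else P s $ k $ l) / det (P s)"
    if "s \<in> S" for s i j
  proof -
    \<comment> \<open>Column \<open>j\<close> of \<open>Q s\<close> solves the linear system with
      the \<open>j\<close>-th unit vector as right-hand side.\<close>
    have "P s *v (Q s *v axis j 1) = axis j 1"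
      using inv[OF that] by (simp add: matrix_vector_mul_assoc)
    then have "(Q s *v axis j 1) $ i = det (\<chi> k l. if l = i then axis j 1 $ k else P s $ k $ l) / det (P s)"
      by (simp add: cramer[OF det_nz[OF that]])
    then show ?thesis by (simp add: matrix_vector_mult_basis column_def)
  qed
  have comp: "continuous_on S (\<lambda>s. P s $ i $ j)" for i j
    using cont by (intro continuous_intros)
  have "continuous_on S (\<lambda>s. det (\<chi> k l. if l = i then axis j 1 $ k else P s $ k $ l) / det (P s))" for i j
  proof (intro continuous_on_divide continuous_on_det)
    show "continuous_on S (\<lambda>s. (\<chi> k l. if l = i then axis j 1 $ k else P s $ k $ l) $ k $ l)" for k l
      by (cases "l = i") (simp_all add: comp)
  qed (use det_nz comp in auto)
  then have "continuous_on S (\<lambda>s. Q s $ i $ j)" for i j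
    by (rule continuous_on_cong[THEN iffD1, rotated 2]) (auto simp: Q)
  then have "continuous_on S (\<lambda>s. \<chi> i j. Q s $ i $ j)"
    by (intro continuous_on_vec_lambda)
  then show ?thesis by simp
qed

section \<open>Integrability of the kernel\<close>

text \<open>Carries the stability estimate from the operator norm to the Frobenius norm, in which
  Bochner integrability is measured. The factor counts the entries, each bounded by the operator
  norm.\<close>

lemma norm_matrix_le_onorm:
  fixes A :: "real ^ 'n ^ 'm"
  shows "norm A \<le> real CARD('m) * real CARD('n) * onorm ((*v) A)"
proof -
  have "norm A \<le> (\<Sum>i\<in>UNIV. norm (A $ i))"
    unfolding norm_vec_def by (rule L2_set_le_sum) simp
  also have "\<dots> \<le> (\<Sum>i\<in>UNIV. \<Sum>j\<in>UNIV. \<bar>A $ i $ j\<bar>)"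
    by (intro sum_mono norm_le_l1_cart)
  also have "\<dots> \<le> (\<Sum>i\<in>(UNIV::'m set). \<Sum>j\<in>(UNIV::'n set). onorm ((*v) A))"
    by (intro sum_mono matrix_component_le_onorm)
  finally show ?thesis by simp
qed

lemma integrable_exp_decay:
  fixes \<gamma> t :: real
  assumes "\<gamma> > 0"
  shows "integrable lebesgue (\<lambda>s. indicat_real {..t} s * exp (- \<gamma> * (t - s)))"
proof -
  have "(\<lambda>x. exp (- \<gamma> * x)) absolutely_integrable_on {0..}"
    by (rule nonnegative_absolutely_integrable_1[OF integrable_on_exp_minus_to_infinity[OF assms]]) simp
  then have "integrable lborel (\<lambda>x. indicat_real {0..} x * exp (- \<gamma> * x))"
    by (simp add: set_integrable_def integrable_completion)
  \<comment> \<open>The reflection \<open>x = t - s\<close> maps the half-line up to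
    \<open>t\<close> onto the nonnegative one.\<close>
  from lborel_integrable_real_affine[OF this, of "-1" t]
  have "integrable lborel (\<lambda>s. indicat_real {..t} s * exp (- \<gamma> * (t - s)))"
    by (simp add: indicator_def)
  then show ?thesis by (simp add: integrable_completion)
qed

lemma integrable_exponentially_stable:
  fixes \<Psi> :: "real \<Rightarrow> real \<Rightarrow> real ^ 'd ^ 'd"
  assumes stable: "exponentially_stable \<Psi>" and cont: "continuous_on UNIV (\<Psi> t)"
  shows "integrable lebesgue (\<lambda>s. indicat_real {..t} s *\<^sub>R \<Psi> t s)"
proof -
  obtain K \<gamma> where "K \<ge> 1" "\<gamma> > 0"
    and K: "\<And>s. s \<le> t \<Longrightarrow> onorm ((*v) (\<Psi> t s)) \<le> K * exp (- \<gamma> * (t - s))"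
    using stable unfolding exponentially_stable_def by metis
  define c where "c = real CARD('d) * real CARD('d) * K"
  show ?thesis
  proof (rule Bochner_Integration.integrable_bound)
    show "integrable lebesgue (\<lambda>s. c * (indicat_real {..t} s * exp (- \<gamma> * (t - s))))"
      by (intro integrable_mult_right integrable_exp_decay \<open>\<gamma> > 0\<close>)
    have [measurable]: "\<Psi> t \<in> borel_measurable borel"
      by (rule borel_measurable_continuous_onI[OF cont])
    show "(\<lambda>s. indicat_real {..t} s *\<^sub>R \<Psi> t s) \<in> borel_measurable lebesgue"
      by (intro measurable_completion) measurable
    have "norm (indicat_real {..t} s *\<^sub>R \<Psi> t s) \<le> c * (indicat_real {..t} s * exp (- \<gamma> * (t - s)))" for s
    proof (cases "s \<le> t")
      case True
      have "norm (\<Psi> t s) \<le> real CARD('d) * real CARD('d) * onorm ((*v) (\<Psi> t s))"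
        by (rule norm_matrix_le_onorm)
      also have "\<dots> \<le> real CARD('d) * real CARD('d) * (K * exp (- \<gamma> * (t - s)))"
        by (intro mult_left_mono K True) auto
      finally show ?thesis using True by (simp add: c_def mult.assoc)
    qed simp
    then show "AE s in lebesgue. norm (indicat_real {..t} s *\<^sub>R \<Psi> t s)
        \<le> norm (c * (indicat_real {..t} s * exp (- \<gamma> * (t - s))))"
      by (intro AE_I2) (metis abs_ge_self order_trans real_norm_def)
  qed
qed

section \<open>The fibre as a scaled image of the unit ball\<close>

lemma admissible_iff:
  "\<xi> \<in> admissible \<longleftrightarrow> \<xi> \<in> borel_measurable lebesgue \<and> (AE t in lebesgue. norm (\<xi> t) \<le> 1)"
proof -
  have "(AE t in lebesgue. norm (\<xi> t) \<le> 1) \<longleftrightarrow> esssup lebesgue (\<lambda>t. ereal (norm (\<xi> t))) \<le> 1"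
    if "\<xi> \<in> borel_measurable lebesgue"
  proof
    assume "AE t in lebesgue. norm (\<xi> t) \<le> 1"
    then show "esssup lebesgue (\<lambda>t. ereal (norm (\<xi> t))) \<le> 1"
      using that by (intro esssup_I) (auto elim: eventually_mono)
  next
    assume le: "esssup lebesgue (\<lambda>t. ereal (norm (\<xi> t))) \<le> 1"
    have "AE t in lebesgue. ereal (norm (\<xi> t)) \<le> esssup lebesgue (\<lambda>t. ereal (norm (\<xi> t)))"
      by (rule esssup_AE)
    then show "AE t in lebesgue. norm (\<xi> t) \<le> 1"
      by eventually_elim (use le order_trans in fastforce)
  qed
  then show ?thesis by (auto simp: admissible_def)
qed

theorem proposition4p7:
  fixes L :: "real \<Rightarrow> real ^ 'd ^ 'd"
    and \<Psi> :: "real \<Rightarrow> real \<Rightarrow> real ^ 'd ^ 'd"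
    and \<rho> :: real
  assumes "CARD('d) \<ge> 2"
    and "\<rho> > 0"
    and "locally_integrable L"
    and "principal_matrix_solution L \<Psi>"
    and "exponentially_stable \<Psi>"
  shows "fibrewise_closed (\<lambda>t. fibre \<rho> \<Psi> t)"
  unfolding fibrewise_closed_def
proof
  fix t
  have "continuous_on UNIV (\<lambda>s. \<Psi> s t)"
    using assms(4) unfolding principal_matrix_solution_def
    by (blast intro: locally_abs_continuous_continuous_on)
  \<comment> \<open>The equation controls only the first time argument. Continuity in the second one
    comes from \<open>\<Psi> s t ** \<Psi> t s = mat 1\<close>.\<close>
  then have "continuous_on UNIV (\<Psi> t)"
    by (rule continuous_on_matrix_right_inverse) (rule principal_matrix_solution_inverse[OF assms(3,4)])
  then have "integrable lebesgue (\<lambda>s. indicat_real {..t} s *\<^sub>R \<Psi> t s)"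
    by (rule integrable_exponentially_stable[OF assms(5)])
  \<comment> \<open>With the indicator absorbed into the kernel, the integral over the half-line
    becomes one over the whole line.\<close>
  from closed_integrals_unit_ball[OF bounded_bilinear_matrix_vector_mult this]
  have "closed ((*\<^sub>R) \<rho> ` (\<lambda>\<xi>. LINT s|lebesgue. (indicat_real {..t} s *\<^sub>R \<Psi> t s) *v \<xi> s) ` admissible)"
    unfolding admissible_iff[symmetric] by (intro closed_scaling) simp
  also have "(*\<^sub>R) \<rho> ` (\<lambda>\<xi>. LINT s|lebesgue. (indicat_real {..t} s *\<^sub>R \<Psi> t s) *v \<xi> s) ` admissible = fibre \<rho> \<Psi> t"
    by (auto simp: fibre_def set_lebesgue_integral_def scaleR_matrix_vector_assoc)
  finally show "closed (fibre \<rho> \<Psi> t)" .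
qed

end
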